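(* Let $n, m \in \mathbb{N}$ and let $s_1, \dots, s_n$ be positive integers with $s_i \le 2^m$ for all $i$. Let $p_1 < \dots < p_q$ be all the distinct primes dividing at least one of the $s_i$, and write $s_i = \prod_{k=1}^q p_k^{\alpha_{i,k}}$ with $\alpha_{i,k} \in \mathbb{Z}_{\ge 0}$. For each $k \in \{1,\dots,q\}$ put $T_k = \frac{1}{2}\sum_{i=1}^n \alpha_{i,k}$, and assume that $T_k$ is an integer for every $k$. Define $$\hat{s}_i = \sum_{k=1}^q \alpha_{i,k}\, k\, (nm)^{k-1} \quad (1 \le i \le n), \qquad \hat{T} = \sum_{k=1}^q T_k\, k\, (nm)^{k-1}.$$ Then $|\hat{s}_i| \le q^2\, m\, (mn)^q$ for all $i \in \{1,\dots,n\}$, and $q \le 2mn$. Consequently the Subset Sum instance $(\hat{s}_1,\dots,\hat{s}_n;\hat{T})$ has size polynomial in $m,n$: there is a polynomial $p$ in two variables, independent of $n$, $m$ and $s_1,\dots,s_n$, such that the total number of bits in the binary representations of $\hat{s}_1, \dots, \hat{s}_n, \hat{T}$ is at most $p(m,n)$.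
   Context: $\mathbb{N}$ denotes the positive integers. Empty sums equal $0$ and empty products equal $1$. The Subset Sum instance $(\hat{s}_1,\dots,\hat{s}_n;\hat{T})$ asks whether some $x\in\{0,1\}^n$ satisfies $\sum_i x_i\hat{s}_i=\hat{T}$; its size is the number of bits needed to write its numbers. *)

theory Defs
  imports
    Complex_Main
    "HOL-Computational_Algebra.Primes"
    "HOL-Computational_Algebra.Polynomial"
    "HOL-Library.Log_Nat"
begin

type_synonym subset_sum_instance = "int list \<times> int"

text \<open>In the library \<open>floorlog 2 0 = 0\<close>, but writing down the number zero takes one digit.\<close>

definition binary_length :: "int \<Rightarrow> nat" where
  "binary_length x = max 1 (floorlog 2 (nat \<bar>x\<bar>))"

definition instance_size :: "subset_sum_instance \<Rightarrow> nat" where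
  "instance_size I = sum_list (map binary_length (fst I)) + binary_length (snd I)"

text \<open>\<open>p 1 < \<dots> < p q\<close> enumerates all primes dividing some \<open>s i\<close> with \<open>1 \<le> i \<le> n\<close>, and
  \<open>\<alpha> i k\<close> is the exponent of \<open>p k\<close> in \<open>s i\<close>. The values of \<open>s\<close>, \<open>p\<close> and \<open>\<alpha>\<close> outside the index
  ranges \<open>{1..n}\<close> and \<open>{1..q}\<close> are irrelevant.\<close>

definition prime_exponents ::
  "nat \<Rightarrow> (nat \<Rightarrow> nat) \<Rightarrow> nat \<Rightarrow> (nat \<Rightarrow> nat) \<Rightarrow> (nat \<Rightarrow> nat \<Rightarrow> nat) \<Rightarrow> bool" where
  "prime_exponents n s q p \<alpha> \<longleftrightarrow>
     strict_mono_on {1..q} p \<and>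
     p ` {1..q} = {r. prime r \<and> (\<exists>i\<in>{1..n}. r dvd s i)} \<and>
     (\<forall>i\<in>{1..n}. s i = (\<Prod>k=1..q. p k ^ \<alpha> i k))"

definition half_exponent_sum :: "nat \<Rightarrow> (nat \<Rightarrow> nat \<Rightarrow> nat) \<Rightarrow> nat \<Rightarrow> rat" where
  "half_exponent_sum n \<alpha> k = 1 / 2 * (\<Sum>i=1..n. of_nat (\<alpha> i k))"

definition admissible ::
  "nat \<Rightarrow> nat \<Rightarrow> (nat \<Rightarrow> nat) \<Rightarrow> nat \<Rightarrow> (nat \<Rightarrow> nat) \<Rightarrow> (nat \<Rightarrow> nat \<Rightarrow> nat) \<Rightarrow> bool" where
  "admissible n m s q p \<alpha> \<longleftrightarrow>
     1 \<le> n \<and> 1 \<le> m \<and>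
     (\<forall>i\<in>{1..n}. 0 < s i \<and> s i \<le> 2 ^ m) \<and>
     prime_exponents n s q p \<alpha> \<and>
     (\<forall>k\<in>{1..q}. half_exponent_sum n \<alpha> k \<in> \<int>)"

definition s_hat :: "nat \<Rightarrow> nat \<Rightarrow> nat \<Rightarrow> (nat \<Rightarrow> nat \<Rightarrow> nat) \<Rightarrow> nat \<Rightarrow> int" where
  "s_hat n m q \<alpha> i = (\<Sum>k=1..q. int (\<alpha> i k) * int k * (int n * int m) ^ (k - 1))"

definition T_hat :: "nat \<Rightarrow> nat \<Rightarrow> nat \<Rightarrow> (nat \<Rightarrow> nat \<Rightarrow> nat) \<Rightarrow> rat" where
  "T_hat n m q \<alpha> =
     (\<Sum>k=1..q. half_exponent_sum n \<alpha> k * of_nat k * (of_nat n * of_nat m) ^ (k - 1))"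

text \<open>A polynomial in two variables \<open>x\<close>, \<open>y\<close> is an element of \<open>\<real>[x][y]\<close>: the outer
  indeterminate is \<open>y\<close>.\<close>

definition poly_xy :: "real poly poly \<Rightarrow> real \<Rightarrow> real \<Rightarrow> real" where
  "poly_xy P x y = poly (poly P [:y:]) x"

end

theory Submission imports Defs begin

text \<open>Every prime is at least 2, so the exponents of each \<open>s i\<close> add up to at most \<open>m\<close>, and every
  prime contributes at least 1 to the total over all \<open>i\<close>; hence \<open>q \<le> m n\<close>. With \<open>N = m n\<close> all
  numbers of the instance are then at most \<open>N ^ (N + 3) \<le> 2 ^ (N (N + 3))\<close>. For the target this
  follows from \<open>2 T\<close> being the sum of all \<open>s_hat\<close>.\<close>

text \<open>Lowering every base to 2 can only shrink the product, and turns it into a single power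
  of 2 whose exponent can be compared with \<open>m\<close>.\<close>

lemma sum_exponents_le:
  assumes "finite A" "\<And>k. k \<in> A \<Longrightarrow> 2 \<le> p k" "(\<Prod>k\<in>A. p k ^ a k) \<le> (2::nat) ^ m"
  shows "sum a A \<le> m"
proof -
  have "(2::nat) ^ sum a A = (\<Prod>k\<in>A. 2 ^ a k)"
    by (rule power_sum)
  also have "\<dots> \<le> (\<Prod>k\<in>A. p k ^ a k)"
    by (intro prod_mono) (auto intro: power_mono assms(2))
  also note assms(3)
  finally show ?thesis
    by simp
qed

lemma admissible_exponents_le:
  assumes "admissible n m s q p \<alpha>" "i \<in> {1..n}"
  shows "(\<Sum>k=1..q. \<alpha> i k) \<le> m"
proof (rule sum_exponents_le)
  fix k assume "k \<in> {1..q}"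
  then have "prime (p k)"
    using assms(1) unfolding admissible_def prime_exponents_def by blast
  then show "2 \<le> p k"
    by (rule prime_ge_2_nat)
next
  show "(\<Prod>k=1..q. p k ^ \<alpha> i k) \<le> 2 ^ m"
    using assms unfolding admissible_def prime_exponents_def by metis
qed simp

lemma admissible_exponent_le:
  assumes "admissible n m s q p \<alpha>" "i \<in> {1..n}" "k \<in> {1..q}"
  shows "\<alpha> i k \<le> m"
  using member_le_sum[of k "{1..q}" "\<alpha> i"] admissible_exponents_le[OF assms(1,2)] assms(3)
  by simp

text \<open>The prime \<open>p k\<close> divides some \<open>s i\<close>, hence one of the factors
  \<open>p j ^ \<alpha> i j\<close>. Since \<open>p j\<close> is prime as well,
  \<open>p k = p j\<close>, and injectivity of \<open>p\<close> forces \<open>j = k\<close>.\<close>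

lemma admissible_exponent_pos:
  assumes adm: "admissible n m s q p \<alpha>" and k: "k \<in> {1..q}"
  obtains i where "i \<in> {1..n}" "1 \<le> \<alpha> i k"
proof -
  have inj: "inj_on p {1..q}"
    using adm unfolding admissible_def prime_exponents_def
    by (blast intro: strict_mono_on_imp_inj_on)
  have image: "p ` {1..q} = {r. prime r \<and> (\<exists>i\<in>{1..n}. r dvd s i)}"
    using adm unfolding admissible_def prime_exponents_def by blast
  then obtain i where i: "i \<in> {1..n}" "p k dvd s i" and prime: "prime (p k)"
    using k by blast
  have "s i = (\<Prod>k=1..q. p k ^ \<alpha> i k)"
    using adm i unfolding admissible_def prime_exponents_def by blast
  then obtain j where j: "j \<in> {1..q}" "p k dvd p j ^ \<alpha> i j"
    using i(2) prime by (auto simp: prime_dvd_prod_iff)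
  have "prime (p j)"
    using image j(1) by blast
  then have "p k = p j"
    using j(2) prime prime_dvd_power primes_dvd_imp_eq by blast
  then have "k = j"
    using inj k j(1) by (auto dest: inj_onD)
  \<comment> \<open>With exponent 0 the prime \<open>p k\<close> would divide 1.\<close>
  then have "1 \<le> \<alpha> i k"
    using j(2) prime by (cases "\<alpha> i k") auto
  then show ?thesis
    using that i(1) by blast
qed

text \<open>Double counting in the matrix of exponents: each of the \<open>q\<close> columns sums to
  at least 1, each of the \<open>n\<close> rows to at most \<open>m\<close>.\<close>

lemma admissible_prime_count_le:
  assumes adm: "admissible n m s q p \<alpha>"
  shows "q \<le> m * n"
proof -
  have "q = (\<Sum>k=1..q. 1)"
    by simp
  also have "\<dots> \<le> (\<Sum>k=1..q. \<Sum>i=1..n. \<alpha> i k)"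
  proof (rule sum_mono)
    fix k assume "k \<in> {1..q}"
    then obtain i where i: "i \<in> {1..n}" "1 \<le> \<alpha> i k"
      by (rule admissible_exponent_pos[OF adm])
    then show "1 \<le> (\<Sum>i=1..n. \<alpha> i k)"
      using member_le_sum[of i "{1..n}" "\<lambda>i. \<alpha> i k"] by simp
  qed
  also have "\<dots> = (\<Sum>i=1..n. \<Sum>k=1..q. \<alpha> i k)"
    by (rule sum.swap)
  also have "\<dots> \<le> (\<Sum>i=1..n. m)"
    by (intro sum_mono admissible_exponents_le[OF adm])
  finally show ?thesis
    by (simp add: mult.commute)
qed

lemma s_hat_nonneg: "0 \<le> s_hat n m q \<alpha> i"
  unfolding s_hat_def by (intro sum_nonneg) simp

lemma admissible_s_hat_le:
  assumes adm: "admissible n m s q p \<alpha>" and i: "i \<in> {1..n}"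
  shows "s_hat n m q \<alpha> i \<le> int q ^ 2 * int m * (int m * int n) ^ q"
proof -
  \<comment> \<open>The base has to be at least 1 so that raising the exponent from
    \<open>k - 1\<close> to \<open>q\<close> does not decrease the power.\<close>
  have pos: "1 \<le> int n * int m"
    using adm mult_mono[of 1 "int n" 1 "int m"] unfolding admissible_def by simp
  have "s_hat n m q \<alpha> i \<le> (\<Sum>k=1..q. int m * int q * (int n * int m) ^ q)"
    unfolding s_hat_def
  proof (rule sum_mono)
    fix k assume k: "k \<in> {1..q}"
    then show "int (\<alpha> i k) * int k * (int n * int m) ^ (k - 1)
        \<le> int m * int q * (int n * int m) ^ q"
      using admissible_exponent_le[OF adm i k] pos
      by (intro mult_mono power_increasing) auto
  qed
  then show ?thesis
    by (simp add: power2_eq_square mult_ac)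
qed

text \<open>The bound is \<open>b + 1\<close> because the value \<open>2 ^ b\<close> itself is
  allowed. It also covers \<open>x = 0\<close>, whose length is 1 by convention.\<close>

lemma binary_length_le:
  assumes "\<bar>x\<bar> \<le> 2 ^ b"
  shows "binary_length x \<le> b + 1"
proof -
  have "nat \<bar>x\<bar> \<le> 2 ^ b"
    using assms by (simp add: nat_le_iff)
  also have "\<dots> < 2 ^ (b + 1)"
    by simp
  finally have "floorlog 2 (nat \<bar>x\<bar>) \<le> b + 1"
    by (intro floorlog_leI) auto
  then show ?thesis
    unfolding binary_length_def by simp
qed

text \<open>Integrality of the half sums turns the rational target into an integer \<open>T\<close>.
  Doubling removes the factor 1/2, and exchanging the two sums expresses \<open>2 * T\<close>
  through the \<open>s_hat\<close> values, so that bounds on these carry over to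
  \<open>T\<close>.\<close>

lemma admissible_T_hat:
  assumes "admissible n m s q p \<alpha>"
  obtains T where "of_int T = T_hat n m q \<alpha>" "2 * T = (\<Sum>i=1..n. s_hat n m q \<alpha> i)"
proof -
  have "\<forall>k\<in>{1..q}. \<exists>c. half_exponent_sum n \<alpha> k = of_int c"
    using assms unfolding admissible_def by (blast elim: Ints_cases)
  then obtain c where c: "\<And>k. k \<in> {1..q} \<Longrightarrow> half_exponent_sum n \<alpha> k = of_int (c k)"
    by metis
  define T where "T = (\<Sum>k=1..q. c k * int k * (int n * int m) ^ (k - 1))"
  have T: "of_int T = T_hat n m q \<alpha>"
    unfolding T_def T_hat_def by (simp add: c)
  have "2 * T_hat n m q \<alpha> = (\<Sum>k=1..q. \<Sum>i=1..n. of_nat (\<alpha> i k) * of_nat k * (of_nat n * of_nat m) ^ (k - 1))"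
    unfolding T_hat_def half_exponent_sum_def
    by (simp add: sum_distrib_left sum_distrib_right)
  also have "\<dots> = of_int (\<Sum>i=1..n. s_hat n m q \<alpha> i)"
    unfolding s_hat_def by (subst sum.swap) simp
  finally have "of_int (2 * T) = (of_int (\<Sum>i=1..n. s_hat n m q \<alpha> i) :: rat)"
    by (simp add: T)
  then have "2 * T = (\<Sum>i=1..n. s_hat n m q \<alpha> i)"
    by (simp only: of_int_eq_iff)
  with T show ?thesis
    by (rule that)
qed

lemma admissible_instance_size_le:
  assumes adm: "admissible n m s q p \<alpha>"
  obtains T where "of_int T = T_hat n m q \<alpha>"
    "instance_size (map (s_hat n m q \<alpha>) [1..<Suc n], T) \<le> (n + 1) * (m * n * (m * n + 3) + 1)"
proof -
  obtain T where T: "of_int T = T_hat n m q \<alpha>" "2 * T = (\<Sum>i=1..n. s_hat n m q \<alpha> i)"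
    by (rule admissible_T_hat[OF adm])
  define N where "N = m * n"
  have mn: "1 \<le> m" "1 \<le> n"
    using adm unfolding admissible_def by auto
  have N: "1 \<le> N" "m \<le> N"
    using mn unfolding N_def by auto
  have q: "q \<le> N"
    using admissible_prime_count_le[OF adm] unfolding N_def .
  \<comment> \<open>The extra factor \<open>n\<close> completes the lone \<open>m\<close> of the
    bound on \<open>s_hat\<close> to \<open>N\<close>. It also pays for the \<open>n\<close>
    summands of \<open>2 * T\<close>, so one bound serves all numbers of the instance.\<close>
  have bound: "int n * s_hat n m q \<alpha> i \<le> 2 ^ (N * (N + 3))" if "i \<in> {1..n}" for i
  proof -
    have "int n * s_hat n m q \<alpha> i \<le> int n * (int q ^ 2 * int m * (int m * int n) ^ q)"
      using admissible_s_hat_le[OF adm that] by (intro mult_left_mono) auto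
    also have "\<dots> = int (q ^ 2 * N * N ^ q)"
      unfolding N_def by (simp add: mult_ac)
    also have "q ^ 2 * N * N ^ q \<le> N ^ 2 * N * N ^ N"
      using q N by (intro mult_mono power_mono power_increasing) auto
    also have "\<dots> = N ^ (N + 3)"
      by (simp add: power_add power2_eq_square power3_eq_cube)
    \<comment> \<open>Here \<open>N \<le> 2 ^ N\<close> makes the bound a power of 2 with exponent
      polynomial in \<open>N\<close>.\<close>
    also have "\<dots> \<le> (2 ^ N) ^ (N + 3)"
      by (intro power_mono) (auto intro: less_imp_le less_exp)
    finally show ?thesis
      by (simp add: power_mult)
  qed
  have s_le: "\<bar>s_hat n m q \<alpha> i\<bar> \<le> 2 ^ (N * (N + 3))" if "i \<in> {1..n}" for i
    using bound[OF that] s_hat_nonneg[of n m q \<alpha> i] mn(2)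
      mult_right_mono[of 1 "int n" "s_hat n m q \<alpha> i"] by simp
  \<comment> \<open>Multiplying by \<open>n\<close> makes \<open>bound\<close> applicable to each
    summand; the factor is cancelled afterwards, as \<open>n\<close> is positive.\<close>
  have "int n * (2 * T) = (\<Sum>i=1..n. int n * s_hat n m q \<alpha> i)"
    unfolding T(2) by (rule sum_distrib_left)
  also have "\<dots> \<le> (\<Sum>i=1..n. 2 ^ (N * (N + 3)))"
    by (intro sum_mono bound)
  finally have "int n * (2 * T) \<le> int n * 2 ^ (N * (N + 3))"
    by simp
  then have "2 * T \<le> 2 ^ (N * (N + 3))"
    using mn(2) by simp
  moreover have "0 \<le> 2 * T"
    unfolding T(2) by (intro sum_nonneg s_hat_nonneg)
  ultimately have T_le: "\<bar>T\<bar> \<le> 2 ^ (N * (N + 3))"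
    by simp
  have "(\<Sum>i\<leftarrow>[1..<Suc n]. binary_length (s_hat n m q \<alpha> i))
      \<le> (\<Sum>i\<leftarrow>[1..<Suc n]. N * (N + 3) + 1)"
    by (intro sum_list_mono binary_length_le s_le) auto
  then have "instance_size (map (s_hat n m q \<alpha>) [1..<Suc n], T) \<le> (n + 1) * (N * (N + 3) + 1)"
    using binary_length_le[OF T_le]
    by (simp add: instance_size_def o_def sum_list_triv del: upt_Suc)
  then show ?thesis
    using that T(1) unfolding N_def by blast
qed

theorem mainTheorem3:
  shows "(\<forall>n m s q p \<alpha>. admissible n m s q p \<alpha> \<longrightarrow>
            (\<forall>i\<in>{1..n}. \<bar>s_hat n m q \<alpha> i\<bar> \<le> int q ^ 2 * int m * (int m * int n) ^ q) \<and>
            q \<le> 2 * m * n)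
       \<and> (\<exists>P :: real poly poly. \<forall>n m s q p \<alpha>. admissible n m s q p \<alpha> \<longrightarrow>
            (\<exists>T :: int. of_int T = T_hat n m q \<alpha> \<and>
               real (instance_size (map (s_hat n m q \<alpha>) [1..<Suc n], T))
                 \<le> poly_xy P (real m) (real n)))"
proof (intro conjI allI impI ballI)
  fix n m s q p \<alpha> i
  assume "admissible n m s q p \<alpha>" "i \<in> {1..n}"
  then show "\<bar>s_hat n m q \<alpha> i\<bar> \<le> int q ^ 2 * int m * (int m * int n) ^ q"
    using admissible_s_hat_le s_hat_nonneg by simp
next
  fix n m s q p \<alpha>
  assume "admissible n m s q p \<alpha>"
  then show "q \<le> 2 * m * n"
    using admissible_prime_count_le by fastforce
next
  \<comment> \<open>The outer indeterminate is \<open>Y\<close>, while \<open>X\<close> is the inner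
    one, embedded as a constant polynomial. \<open>P\<close> copies the bound on the size, with
    \<open>X\<close> for \<open>m\<close> and \<open>Y\<close> for \<open>n\<close>.\<close>
  define X Y :: "real poly poly" where "X = [:[:0, 1:]:]" and "Y = [:0, 1:]"
  define P where "P = (Y + 1) * (X * Y * (X * Y + [:[:3:]:]) + 1)"
  have P: "poly_xy P (real m) (real n) = real ((n + 1) * (m * n * (m * n + 3) + 1))" for m n
    unfolding P_def X_def Y_def poly_xy_def by (simp add: algebra_simps)
  show "\<exists>P :: real poly poly. \<forall>n m s q p \<alpha>. admissible n m s q p \<alpha> \<longrightarrow>
            (\<exists>T :: int. of_int T = T_hat n m q \<alpha> \<and>
               real (instance_size (map (s_hat n m q \<alpha>) [1..<Suc n], T))
                 \<le> poly_xy P (real m) (real n))"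
  proof (intro exI[of _ P] allI impI)
    fix n m s q p \<alpha>
    assume "admissible n m s q p \<alpha>"
    then obtain T where "of_int T = T_hat n m q \<alpha>"
      "instance_size (map (s_hat n m q \<alpha>) [1..<Suc n], T) \<le> (n + 1) * (m * n * (m * n + 3) + 1)"
      by (rule admissible_instance_size_le)
    then show "\<exists>T :: int. of_int T = T_hat n m q \<alpha> \<and>
        real (instance_size (map (s_hat n m q \<alpha>) [1..<Suc n], T)) \<le> poly_xy P (real m) (real n)"
      unfolding P of_nat_le_iff by blast
  qed
qed

end
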